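(* Let $G$ be a digraph and let $H$ be the underlying undirected graph of $G$. Then the mim-width of $H$ is at most the bi-mim-width of $G$, and the linear mim-width of $H$ is at most the linear bi-mim-width of $G$. On the other hand, the class of tournaments has unbounded bi-mim-width, while their underlying undirected graphs have linear mim-width $1$.
   Context: All graphs and digraphs are finite; undirected graphs are simple; digraphs have no multiple edges but may have loops, with $E(G)\subseteq V(G)\times V(G)$. The underlying undirected graph of a digraph is obtained by replacing every edge by an undirected edge and removing multiple edges. A tournament is an orientation of a complete graph (each edge $uv$ replaced by exactly one of $(u,v),(v,u)$). A class has unbounded bi-mim-width if no constant bounds the bi-mim-width of all its members. An induced matching of a graph or digraph is a set $M$ of edges, no two sharing an endpoint, such that no edge of the graph meets two distinct edges of $M$; $\nu(\cdot)$ is the maximum size of an induced matching. $\bar A=V(G)\setminus A$. For an undirected graph $G$ and disjoint $A,B$, $G[A,B]$ is the bipartite graph on $A\cup B$ consisting of the edges of $G$ between $A$ and $B$, and $\mathrm{mim}_G(A)=\nu(G[A,\bar A])$. For a digraph $G$ and disjoint $A,B$, $G[A\to B]$ is the bipartite digraph on $A\cup B$ with edge set $E(G)\cap(A\times B)$, and $\mathrm{bimim}_G(A)=\nu(G[A\to\bar A])+\nu(G[\bar A\to A])$. A tree is subcubic if it has at least two vertices and every internal vertex has degree $3$; it is a caterpillar if it contains a path $P$ such that every vertex outside $P$ has a neighbor in $P$. A branch decomposition of a graph or digraph $G$ is a pair $(T,L)$ of a subcubic tree $T$ and a bijection $L$ from $V(G)$ to the leaves of $T$; it is linear if $T$ is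 a caterpillar (so decompositions exist only if $|V(G)|\ge 2$). Each edge $e$ of $T$ yields a cut $(A_e,B_e)$, where $A_e,B_e$ are the sets of vertices mapped to the leaves in the two components of $T-e$. The mim-width (respectively bi-mim-width) of $(T,L)$ is $\max_{e\in E(T)}\mathrm{mim}_G(A_e)$ (respectively $\max_{e\in E(T)}\mathrm{bimim}_G(A_e)$). The (linear) mim-width of an undirected graph, respectively (linear) bi-mim-width of a digraph, is the minimum over all its (linear) branch decompositions. *)

theory Defs
  imports "Graph_Theory.Pair_Digraph"
begin

text \<open>Digraphs are the pair digraphs of the AFP entry Graph\_Theory: the locale
  \<open>pair_fin_digraph\<close> says that the vertex set is finite and that
  \<open>parcs G \<subseteq> pverts G \<times> pverts G\<close>; loops are allowed.\<close>

record 'a ugraph =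
  uverts :: "'a set"
  uedges :: "'a set set"

definition simple_ugraph :: "'a ugraph \<Rightarrow> bool" where
  "simple_ugraph G \<longleftrightarrow> finite (uverts G) \<and>
     (\<forall>e\<in>uedges G. \<exists>u\<in>uverts G. \<exists>v\<in>uverts G. u \<noteq> v \<and> e = {u, v})"

text \<open>Loops of the digraph are dropped, since undirected graphs are simple.\<close>

definition underlying_ugraph :: "'a pair_pre_digraph \<Rightarrow> 'a ugraph" where
  "underlying_ugraph G =
     \<lparr>uverts = pverts G, uedges = {{u, v} | u v. (u, v) \<in> parcs G \<and> u \<noteq> v}\<rparr>"

definition tournament :: "'a pair_pre_digraph \<Rightarrow> bool" where
  "tournament G \<longleftrightarrow> pair_fin_digraph G \<and> (\<forall>v. (v, v) \<notin> parcs G) \<and>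
     (\<forall>u\<in>pverts G. \<forall>v\<in>pverts G. u \<noteq> v \<longrightarrow> ((u, v) \<in> parcs G \<longleftrightarrow> (v, u) \<notin> parcs G))"


subsection \<open>Induced matchings\<close>

text \<open>The edges may be of any type; \<open>ends e\<close> is the set of endpoints of \<open>e\<close>. This covers
  undirected edges (\<open>ends e = e\<close>) and arcs (\<open>ends (u, v) = {u, v}\<close>).
  Isolated vertices are irrelevant, so a graph is given by its edge set \<open>E\<close> only.\<close>

definition induced_matching :: "('e \<Rightarrow> 'a set) \<Rightarrow> 'e set \<Rightarrow> 'e set \<Rightarrow> bool" where
  "induced_matching ends E M \<longleftrightarrow> M \<subseteq> E \<and>
     (\<forall>e\<in>M. \<forall>f\<in>M. e \<noteq> f \<longrightarrow> ends e \<inter> ends f = {}) \<and>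
     (\<forall>g\<in>E. \<forall>e\<in>M. \<forall>f\<in>M. e \<noteq> f \<longrightarrow> ends g \<inter> ends e = {} \<or> ends g \<inter> ends f = {})"

definition induced_matching_number :: "('e \<Rightarrow> 'a set) \<Rightarrow> 'e set \<Rightarrow> nat" where
  "induced_matching_number ends E = Max {card M | M. induced_matching ends E M}"

definition edges_between :: "'a ugraph \<Rightarrow> 'a set \<Rightarrow> 'a set \<Rightarrow> 'a set set" where
  "edges_between G A B = {e \<in> uedges G. \<exists>u\<in>A. \<exists>v\<in>B. e = {u, v}}"

definition mim :: "'a ugraph \<Rightarrow> 'a set \<Rightarrow> nat" where
  "mim G A = induced_matching_number (\<lambda>e. e) (edges_between G A (uverts G - A))"

definition bimim :: "'a pair_pre_digraph \<Rightarrow> 'a set \<Rightarrow> nat" where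
  "bimim G A =
     induced_matching_number (\<lambda>(u, v). {u, v}) (parcs G \<inter> A \<times> (pverts G - A)) +
     induced_matching_number (\<lambda>(u, v). {u, v}) (parcs G \<inter> (pverts G - A) \<times> A)"


subsection \<open>Subcubic trees and caterpillars\<close>

text \<open>The predicate \<open>tree\<close> of Graph\_Theory is not suitable here: it forbids directed cycles only.\<close>

definition uadj :: "'a ugraph \<Rightarrow> ('a \<times> 'a) set" where
  "uadj G = {(u, v). {u, v} \<in> uedges G}"

definition upath :: "'a ugraph \<Rightarrow> 'a list \<Rightarrow> bool" where
  "upath G xs \<longleftrightarrow> xs \<noteq> [] \<and> set xs \<subseteq> uverts G \<and> distinct xs \<and>
     successively (\<lambda>u v. {u, v} \<in> uedges G) xs"

definition ucycle :: "'a ugraph \<Rightarrow> 'a list \<Rightarrow> bool" where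
  "ucycle G xs \<longleftrightarrow> upath G xs \<and> 3 \<le> length xs \<and> {last xs, hd xs} \<in> uedges G"

definition ucomponents :: "'a ugraph \<Rightarrow> 'a set set" where
  "ucomponents G = {{y \<in> uverts G. (x, y) \<in> (uadj G)\<^sup>*} | x. x \<in> uverts G}"

definition utree :: "'a ugraph \<Rightarrow> bool" where
  "utree T \<longleftrightarrow> simple_ugraph T \<and> uverts T \<noteq> {} \<and>
     (\<forall>x\<in>uverts T. \<forall>y\<in>uverts T. (x, y) \<in> (uadj T)\<^sup>*) \<and> (\<nexists>xs. ucycle T xs)"

definition udegree :: "'a ugraph \<Rightarrow> 'a \<Rightarrow> nat" where
  "udegree G v = card {e \<in> uedges G. v \<in> e}"

definition uleaves :: "'a ugraph \<Rightarrow> 'a set" where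
  "uleaves T = {v \<in> uverts T. udegree T v = 1}"

definition subcubic_tree :: "'a ugraph \<Rightarrow> bool" where
  "subcubic_tree T \<longleftrightarrow> utree T \<and> 2 \<le> card (uverts T) \<and>
     (\<forall>v\<in>uverts T - uleaves T. udegree T v = 3)"

definition caterpillar :: "'a ugraph \<Rightarrow> bool" where
  "caterpillar T \<longleftrightarrow>
     (\<exists>P. upath T P \<and> (\<forall>v\<in>uverts T - set P. \<exists>u\<in>set P. {u, v} \<in> uedges T))"


subsection \<open>Branch decompositions and widths\<close>

definition branch_decomposition :: "'a set \<Rightarrow> 'b ugraph \<Rightarrow> ('a \<Rightarrow> 'b) \<Rightarrow> bool" where
  "branch_decomposition V T L \<longleftrightarrow> subcubic_tree T \<and> bij_betw L V (uleaves T)"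

definition linear_branch_decomposition :: "'a set \<Rightarrow> 'b ugraph \<Rightarrow> ('a \<Rightarrow> 'b) \<Rightarrow> bool" where
  "linear_branch_decomposition V T L \<longleftrightarrow> branch_decomposition V T L \<and> caterpillar T"

text \<open>Both sides of every cut are taken into account; as the cut functions \<open>mim G\<close> and
  \<open>bimim G\<close> agree on a set and its complement, this is the maximum of \<open>f A\<^sub>e\<close> over the
  edges \<open>e\<close> of the tree, whichever side is called \<open>A\<^sub>e\<close>.\<close>

definition decomposition_width ::
  "('a set \<Rightarrow> nat) \<Rightarrow> 'a set \<Rightarrow> 'b ugraph \<Rightarrow> ('a \<Rightarrow> 'b) \<Rightarrow> nat" where
  "decomposition_width f V T L =
     Max {f {v \<in> V. L v \<in> C} | e C.
            e \<in> uedges T \<and> C \<in> ucomponents (T\<lparr>uedges := uedges T - {e}\<rparr>)}"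

text \<open>As trees are finite, it is no restriction to take their vertices from \<^typ>\<open>nat\<close>.
  Decompositions exist only for at least two vertices; for smaller graphs the widths below
  are meaningless.\<close>

definition mim_width :: "'a ugraph \<Rightarrow> nat" where
  "mim_width G = (LEAST w. \<exists>(T :: nat ugraph) L.
     branch_decomposition (uverts G) T L \<and> w = decomposition_width (mim G) (uverts G) T L)"

definition linear_mim_width :: "'a ugraph \<Rightarrow> nat" where
  "linear_mim_width G = (LEAST w. \<exists>(T :: nat ugraph) L.
     linear_branch_decomposition (uverts G) T L \<and>
     w = decomposition_width (mim G) (uverts G) T L)"

definition bimim_width :: "'a pair_pre_digraph \<Rightarrow> nat" where
  "bimim_width G = (LEAST w. \<exists>(T :: nat ugraph) L.
     branch_decomposition (pverts G) T L \<and>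
     w = decomposition_width (bimim G) (pverts G) T L)"

definition linear_bimim_width :: "'a pair_pre_digraph \<Rightarrow> nat" where
  "linear_bimim_width G = (LEAST w. \<exists>(T :: nat ugraph) L.
     linear_branch_decomposition (pverts G) T L \<and>
     w = decomposition_width (bimim G) (pverts G) T L)"

definition unbounded_bimim_width :: "'a pair_pre_digraph set \<Rightarrow> bool" where
  "unbounded_bimim_width \<C> \<longleftrightarrow> (\<nexists>c. \<forall>G\<in>\<C>. bimim_width G \<le> c)"

end

theory Submission
  imports Defs
begin

text \<open>
  \<^emph>\<open>The two inequalities.\<close> Every edge of the cut \<open>H[A, V - A]\<close> comes from an arc of \<open>G\<close> that leaves
  \<open>A\<close> or from one that enters \<open>A\<close>. An induced matching of the undirected cut therefore splits into
  two sets of arcs, and each is an induced matching of its directed cut, because a directed cut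
  has only edges that the undirected cut has too. So \<open>mim H A \<le> bimim G A\<close> for every \<open>A\<close>
  (lemma \<open>mim_le_bimim\<close>), and the inequality passes to the width of each decomposition and then to
  the minimum over all of them.

  \<^emph>\<open>Tournaments have linear mim-width 1.\<close> The underlying graph is complete. Two edges \<open>ab\<close> and
  \<open>cd\<close> of a cut are joined by the edge \<open>ad\<close>, which crosses the cut as well, so every cut has value
  at most 1, and the value is 1 as soon as both sides are nonempty.

  \<^emph>\<open>Tournaments have unbounded bi-mim-width.\<close> Orient the complete graph according to an incidence
  structure: there are \<open>n\<close> points and one vertex for each pair of points; a point dominates
  the pairs that contain it and is dominated by all other pairs, and the direction of the remaining
  arcs is arbitrary.
  A subcubic tree has, for any set of leaves, an edge with at least a third of them on either side
  (\<open>balanced_edge\<close>). Applied to the leaves of the points, it yields a cut \<open>(X, V - X)\<close> with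
  points \<open>p\<^sub>1, \<dots>, p\<^sub>m\<close> in \<open>X\<close> and \<open>q\<^sub>1, \<dots>, q\<^sub>m\<close> outside, where \<open>m \<ge> n / 3\<close>. Wherever the pair
  \<open>b\<^sub>i = {p\<^sub>i, q\<^sub>i}\<close> lies, one of the arcs \<open>(p\<^sub>i, b\<^sub>i)\<close> and \<open>(q\<^sub>i, b\<^sub>i)\<close> crosses the cut. The crossing arcs
  of the first kind form an induced matching from \<open>X\<close> to \<open>V - X\<close>, those of the second kind one in
  the opposite direction, as a point among the \<open>p\<^sub>i, q\<^sub>i\<close> is incident with just one of the
  pairs \<open>b\<^sub>j\<close>. Together these are \<open>m\<close> arcs, so the cut has value at least \<open>n / 3\<close>
  (\<open>bimim_incidence_tournament_ge\<close>).

  All the widths are least elements of sets of numbers, and nothing can be said about them before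
  these sets are known to be nonempty. This is why caterpillars with any number \<open>n \<ge> 2\<close> of leaves
  have to be constructed (\<open>caterpillar_exists\<close>).
\<close>

section \<open>Induced matchings\<close>

lemma induced_matching_card_le:
  assumes "finite E" and "induced_matching ends E M"
  shows "card M \<le> induced_matching_number ends E"
proof -
  have "{card M | M. induced_matching ends E M} \<subseteq> card ` Pow E"
    by (auto simp: induced_matching_def)
  then have "finite {card M | M. induced_matching ends E M}"
    using assms(1) by (meson finite_Pow_iff finite_imageI finite_subset)
  then show ?thesis
    unfolding induced_matching_number_def using assms(2) by (intro Max_ge) auto
qed

lemma induced_matching_number_attained:
  assumes "finite E"
  obtains M where "induced_matching ends E M" "card M = induced_matching_number ends E"
proof -
  let ?S = "{card M | M. induced_matching ends E M}"
  have "?S \<subseteq> card ` Pow E"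
    by (auto simp: induced_matching_def)
  then have "finite ?S"
    using assms(1) by (meson finite_Pow_iff finite_imageI finite_subset)
  moreover have "induced_matching ends E {}"
    by (simp add: induced_matching_def)
  then have "?S \<noteq> {}" by blast
  ultimately have "Max ?S \<in> ?S" by (rule Max_in)
  then obtain M where "Max ?S = card M" "induced_matching ends E M" by blast
  then show ?thesis
    using that[of M] by (simp add: induced_matching_number_def)
qed

lemma induced_matching_meets_once:
  assumes "induced_matching ends E M" "g \<in> E" "e \<in> M" "f \<in> M"
    and "ends g \<inter> ends e \<noteq> {}" "ends g \<inter> ends f \<noteq> {}"
  shows "e = f"
proof (rule ccontr)
  assume "e \<noteq> f"
  have "\<forall>g\<in>E. \<forall>e\<in>M. \<forall>f\<in>M. e \<noteq> f \<longrightarrow> ends g \<inter> ends e = {} \<or> ends g \<inter> ends f = {}"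
    using assms(1) unfolding induced_matching_def by (elim conjE)
  from this[rule_format, OF assms(2,3,4) \<open>e \<noteq> f\<close>] show False
    using assms(5,6) by blast
qed

text \<open>Injectivity of the endpoint map on \<open>F\<close> serves to keep distinct arcs over distinct edges;
  for the arcs that cross a cut in one fixed direction it holds automatically. Passing to fewer
  edges \<open>F\<close> only weakens the condition that no edge meets two members of the matching.\<close>

lemma induced_matching_pullback:
  assumes "induced_matching (\<lambda>e. e) E M" and "inj_on ends F" and "ends ` F \<subseteq> E"
  shows "induced_matching ends F {a \<in> F. ends a \<in> M}"
proof -
  let ?N = "{a \<in> F. ends a \<in> M}"
  have ne: "ends e \<noteq> ends f" if "e \<in> ?N" "f \<in> ?N" "e \<noteq> f" for e f
    using that inj_onD[OF assms(2)] by blast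
  have disj: "\<forall>e\<in>M. \<forall>f\<in>M. e \<noteq> f \<longrightarrow> e \<inter> f = {}"
    using assms(1) unfolding induced_matching_def by (elim conjE)
  show ?thesis
    unfolding induced_matching_def
  proof (intro conjI ballI impI)
    fix e f assume "e \<in> ?N" "f \<in> ?N" "e \<noteq> f"
    then show "ends e \<inter> ends f = {}" using ne disj by blast
  next
    fix g e f assume "g \<in> F" and ef: "e \<in> ?N" "f \<in> ?N" "e \<noteq> f"
    then have "ends g \<in> E" "ends e \<in> M" "ends f \<in> M" using assms(3) by auto
    then show "ends g \<inter> ends e = {} \<or> ends g \<inter> ends f = {}"
      using induced_matching_meets_once[OF assms(1)] ne[OF ef] by blast
  qed blast
qed

text \<open>Since all edges lead from \<open>A\<close> to \<open>B\<close>, an edge can join two members of the family only by going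
  from one source to another target, and \<open>only\<close> excludes that. The same assumption makes
  both endpoint maps injective.\<close>

lemma induced_matching_of_family:
  assumes E: "E \<subseteq> A \<times> B" and disj: "A \<inter> B = {}"
    and arcs: "\<And>p. p \<in> P \<Longrightarrow> (s p, t p) \<in> E"
    and only: "\<And>p q. \<lbrakk>p \<in> P; q \<in> P; (s p, t q) \<in> E\<rbrakk> \<Longrightarrow> p = q"
  shows "induced_matching (\<lambda>(u, v). {u, v}) E ((\<lambda>p. (s p, t p)) ` P)"
proof -
  have sides: "s p \<in> A" "t p \<in> B" if "p \<in> P" for p
    using subsetD[OF E arcs[OF that]] by auto
  have st: "s p \<noteq> t q" if "p \<in> P" "q \<in> P" for p q
    using sides(1)[OF that(1)] sides(2)[OF that(2)] disj by auto
  have ss: "p = q" if "p \<in> P" "q \<in> P" "s p = s q" for p q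
    using only[OF that(1,2)] arcs[OF that(2)] that(3) by simp
  have tt: "p = q" if "p \<in> P" "q \<in> P" "t p = t q" for p q
    using only[OF that(1,2)] arcs[OF that(1)] that(3) by simp
  have src: "s p \<noteq> y \<and> t p \<noteq> x" if "p \<in> P" "(x, y) \<in> E" for p x y
    using subsetD[OF E that(2)] sides[OF that(1)] disj by auto
  have *: "p = q" if "(x, y) \<in> E" "p \<in> P" "q \<in> P" "{x, y} \<inter> {s p, t p} \<noteq> {}"
      "{x, y} \<inter> {s q, t q} \<noteq> {}" for x y p q
  proof -
    have "x = s p \<or> y = t p"
      using src[OF that(2,1)] that(4) by auto
    moreover have "x = s q \<or> y = t q"
      using src[OF that(3,1)] that(5) by auto
    \<comment> \<open>In the mixed cases \<open>(x, y)\<close> itself runs from one source to the other target.\<close>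
    ultimately have "s p = s q \<or> t p = t q \<or> (s p, t q) \<in> E \<or> (s q, t p) \<in> E"
      using that(1) by blast
    then show ?thesis
      using ss[OF that(2,3)] tt[OF that(2,3)] only[OF that(2,3)] only[OF that(3,2)] by blast
  qed
  show "induced_matching (\<lambda>(u, v). {u, v}) E ((\<lambda>p. (s p, t p)) ` P)"
    unfolding induced_matching_def
  proof (intro conjI ballI impI)
    show "(\<lambda>p. (s p, t p)) ` P \<subseteq> E" using arcs by blast
  next
    fix e f assume "e \<in> (\<lambda>p. (s p, t p)) ` P" "f \<in> (\<lambda>p. (s p, t p)) ` P" "e \<noteq> f"
    then obtain p q where "p \<in> P" "q \<in> P" "e = (s p, t p)" "f = (s q, t q)" "p \<noteq> q"
      by blast
    moreover from this have "s p \<noteq> s q" "t p \<noteq> t q" "s p \<noteq> t q" "s q \<noteq> t p"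
      using st ss tt by blast+
    ultimately show "(case e of (u, v) \<Rightarrow> {u, v}) \<inter> (case f of (u, v) \<Rightarrow> {u, v}) = {}"
      by auto
  next
    fix g e f
    assume "g \<in> E" "e \<in> (\<lambda>p. (s p, t p)) ` P" "f \<in> (\<lambda>p. (s p, t p)) ` P" "e \<noteq> f"
    then obtain p q where "p \<in> P" "q \<in> P" "e = (s p, t p)" "f = (s q, t q)" "p \<noteq> q"
      by blast
    moreover obtain x y where "g = (x, y)" by (cases g)
    moreover have "(x, y) \<in> E" using \<open>g \<in> E\<close> \<open>g = (x, y)\<close> by simp
    ultimately show "(case g of (u, v) \<Rightarrow> {u, v}) \<inter> (case e of (u, v) \<Rightarrow> {u, v}) = {} \<or>
        (case g of (u, v) \<Rightarrow> {u, v}) \<inter> (case f of (u, v) \<Rightarrow> {u, v}) = {}"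
      using *[of x y p q] by auto
  qed
qed


section \<open>Cut functions of a digraph and of its underlying graph\<close>

lemma finite_edges_between_underlying:
  assumes "pair_fin_digraph G"
  shows "finite (edges_between (underlying_ugraph G) A B)"
proof -
  have "finite (parcs G)"
    using assms by (simp add: pair_fin_digraph.pair_finite_arcs)
  moreover have "edges_between (underlying_ugraph G) A B \<subseteq> (\<lambda>(u, v). {u, v}) ` parcs G"
    by (auto simp: edges_between_def underlying_ugraph_def)
  ultimately show ?thesis by (meson finite_imageI finite_subset)
qed

text \<open>The members of an optimal matching are covered by those that come from arcs in \<open>F1\<close> and those
  that come from arcs in \<open>F2\<close>. An edge may come from two opposite arcs and be counted twice, which
  does not harm the inequality.\<close>

lemma mim_le_bimim:
  assumes G: "pair_fin_digraph G"
  shows "mim (underlying_ugraph G) A \<le> bimim G A"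
proof -
  let ?ends = "\<lambda>(u, v). {u, v}"
  let ?E = "edges_between (underlying_ugraph G) A (pverts G - A)"
  define F1 where "F1 = parcs G \<inter> A \<times> (pverts G - A)"
  define F2 where "F2 = parcs G \<inter> (pverts G - A) \<times> A"
  have fin: "finite F1" "finite F2"
    using G by (simp_all add: F1_def F2_def pair_fin_digraph.pair_finite_arcs)
  obtain M where M: "induced_matching (\<lambda>e. e) ?E M"
    "card M = induced_matching_number (\<lambda>e. e) ?E"
    using induced_matching_number_attained[OF finite_edges_between_underlying[OF G]] .
  have inj: "inj_on ?ends F1" "inj_on ?ends F2"
    by (auto simp: inj_on_def F1_def F2_def doubleton_eq_iff)
  have sub: "?ends ` F1 \<subseteq> ?E"
    by (fastforce simp: edges_between_def underlying_ugraph_def F1_def)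
  have sub': "?ends ` F2 \<subseteq> ?E"
    by (fastforce simp: edges_between_def underlying_ugraph_def F2_def doubleton_eq_iff)
  have le: "card {a \<in> F1. ?ends a \<in> M} \<le> induced_matching_number ?ends F1"
      "card {a \<in> F2. ?ends a \<in> M} \<le> induced_matching_number ?ends F2"
    using induced_matching_card_le[OF fin(1) induced_matching_pullback[OF M(1) inj(1) sub]]
      induced_matching_card_le[OF fin(2) induced_matching_pullback[OF M(1) inj(2) sub']]
    by simp_all
  have "M \<subseteq> ?ends ` {a \<in> F1. ?ends a \<in> M} \<union> ?ends ` {a \<in> F2. ?ends a \<in> M}"
  proof
    fix e assume e: "e \<in> M"
    then have "e \<in> ?E" using M(1) by (auto simp: induced_matching_def)
    then obtain u v x y where uv: "e = {u, v}" "(u, v) \<in> parcs G"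
      and xy: "e = {x, y}" "x \<in> A" "y \<in> pverts G - A"
      by (auto simp: edges_between_def underlying_ugraph_def)
    from uv(1) xy(1) have "u = x \<and> v = y \<or> u = y \<and> v = x"
      by (auto simp: doubleton_eq_iff)
    then have "(u, v) \<in> F1 \<or> (u, v) \<in> F2"
      using uv xy by (auto simp: F1_def F2_def)
    then show "e \<in> ?ends ` {a \<in> F1. ?ends a \<in> M} \<union> ?ends ` {a \<in> F2. ?ends a \<in> M}"
      using uv(1) e by (auto intro: rev_image_eqI)
  qed
  then have "card M \<le> card (?ends ` {a \<in> F1. ?ends a \<in> M} \<union> ?ends ` {a \<in> F2. ?ends a \<in> M})"
    using fin by (intro card_mono) auto
  also have "\<dots> \<le> card (?ends ` {a \<in> F1. ?ends a \<in> M}) + card (?ends ` {a \<in> F2. ?ends a \<in> M})"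
    by (rule card_Un_le)
  also have "\<dots> \<le> card {a \<in> F1. ?ends a \<in> M} + card {a \<in> F2. ?ends a \<in> M}"
    using fin by (intro add_mono card_image_le) auto
  also have "\<dots> \<le> bimim G A"
    using le by (simp add: bimim_def F1_def F2_def)
  finally show ?thesis
    using M(2) by (simp add: mim_def underlying_ugraph_def)
qed

lemma underlying_tournament_edges:
  assumes "tournament G"
  shows "uedges (underlying_ugraph G) = {{u, v} | u v. u \<in> pverts G \<and> v \<in> pverts G \<and> u \<noteq> v}"
proof -
  have "pair_wf_digraph G"
    using assms by (auto simp: tournament_def pair_fin_digraph_def)
  then have in_V: "u \<in> pverts G" "v \<in> pverts G" if "(u, v) \<in> parcs G" for u v
    using that pair_wf_digraph.arc_fst_in_verts pair_wf_digraph.arc_snd_in_verts by fastforce+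
  have "(u, v) \<in> parcs G \<or> (v, u) \<in> parcs G" if "u \<in> pverts G" "v \<in> pverts G" "u \<noteq> v" for u v
    using that assms unfolding tournament_def by blast
  then have "{u, v} \<in> uedges (underlying_ugraph G)"
    if "u \<in> pverts G" "v \<in> pverts G" "u \<noteq> v" for u v
    using that by (fastforce simp: underlying_ugraph_def doubleton_eq_iff)
  moreover have "uedges (underlying_ugraph G) \<subseteq>
      {{u, v} | u v. u \<in> pverts G \<and> v \<in> pverts G \<and> u \<noteq> v}"
    using in_V by (fastforce simp: underlying_ugraph_def)
  ultimately show ?thesis by blast
qed

text \<open>Two members \<open>{a, b}\<close> and \<open>{c, d}\<close> of a matching in a cut are both met by the edge \<open>{a, d}\<close>,
  which a complete graph has in the same cut.\<close>

lemma mim_underlying_tournament_le: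
  assumes "tournament G"
  shows "mim (underlying_ugraph G) A \<le> 1"
proof -
  let ?E = "edges_between (underlying_ugraph G) A (pverts G - A)"
  have G: "pair_fin_digraph G" using assms by (simp add: tournament_def)
  obtain M where M: "induced_matching (\<lambda>e. e) ?E M"
    "card M = induced_matching_number (\<lambda>e. e) ?E"
    using induced_matching_number_attained[OF finite_edges_between_underlying[OF G]] .
  have "e = f" if ef: "e \<in> M" "f \<in> M" for e f
  proof (rule ccontr)
    assume "e \<noteq> f"
    have "e \<in> ?E" "f \<in> ?E" using M(1) ef by (auto simp: induced_matching_def)
    then obtain a b c d where e: "e = {a, b}" "a \<in> A" "b \<in> pverts G - A" "e \<in> ?E"
      and f: "f = {c, d}" "c \<in> A" "d \<in> pverts G - A"
      unfolding edges_between_def by blast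
    from e have "a \<in> pverts G"
      by (auto simp: edges_between_def underlying_tournament_edges[OF assms] doubleton_eq_iff)
    then have "{a, d} \<in> ?E"
      using e f by (auto simp: edges_between_def underlying_tournament_edges[OF assms])
    moreover have "{a, d} \<inter> e \<noteq> {}" "{a, d} \<inter> f \<noteq> {}" using e f by auto
    ultimately show False
      using induced_matching_meets_once[OF M(1) _ ef] \<open>e \<noteq> f\<close> by blast
  qed
  then have "card M \<le> 1"
    by (cases "finite M") (auto simp: card_le_Suc0_iff_eq)
  then show ?thesis
    using M(2) by (simp add: mim_def underlying_ugraph_def)
qed

lemma mim_underlying_tournament_pos:
  assumes "tournament G" and "u \<in> pverts G" "u \<in> A" "v \<in> pverts G" "v \<notin> A"
  shows "1 \<le> mim (underlying_ugraph G) A"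
proof -
  let ?E = "edges_between (underlying_ugraph G) A (pverts G - A)"
  have G: "pair_fin_digraph G" using assms by (simp add: tournament_def)
  have "u \<noteq> v" using assms by auto
  then have "{u, v} \<in> ?E"
    using assms by (auto simp: edges_between_def underlying_tournament_edges[OF assms(1)])
  then have "induced_matching (\<lambda>e. e) ?E {{u, v}}"
    by (auto simp: induced_matching_def)
  from induced_matching_card_le[OF finite_edges_between_underlying[OF G] this]
  show ?thesis by (simp add: mim_def underlying_ugraph_def)
qed


section \<open>Balanced cuts of subcubic trees\<close>

lemma uadj_sym: "(x, y) \<in> uadj G \<Longrightarrow> (y, x) \<in> uadj G"
  by (simp add: uadj_def insert_commute)

lemma uadj_rtrancl_sym: "(x, y) \<in> (uadj G)\<^sup>* \<Longrightarrow> (y, x) \<in> (uadj G)\<^sup>*"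
  by (metis sym_def sym_rtrancl uadj_sym)

lemma simple_edge_verts:
  assumes "simple_ugraph G" "{u, v} \<in> uedges G"
  shows "u \<in> uverts G" "v \<in> uverts G" "u \<noteq> v"
  using assms by (fastforce simp: simple_ugraph_def doubleton_eq_iff)+

lemma upath_of_reachable:
  assumes "(x, y) \<in> (uadj G)\<^sup>*" and "simple_ugraph G" and "x \<in> uverts G"
  shows "\<exists>xs. upath G xs \<and> hd xs = x \<and> last xs = y"
  using assms(1)
proof (induction rule: rtrancl_induct)
  case base
  have "upath G [x]" using assms(3) by (simp add: upath_def)
  then show ?case by (intro exI[of _ "[x]"]) simp
next
  case (step y z)
  then obtain xs where xs: "upath G xs" "hd xs = x" "last xs = y" by blast
  have yz: "{y, z} \<in> uedges G" using step by (simp add: uadj_def)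
  show ?case
  proof (cases "z \<in> set xs")
    case True
    then obtain ys zs where "xs = ys @ z # zs" by (meson split_list)
    then have "upath G (ys @ [z])" "hd (ys @ [z]) = x"
      using xs by (auto simp: upath_def successively_append_iff hd_append)
    then show ?thesis by (metis last_snoc)
  next
    case False
    then have "upath G (xs @ [z])" "hd (xs @ [z]) = x"
      using xs yz simple_edge_verts[OF assms(2) yz]
      by (auto simp: upath_def successively_append_iff)
    then show ?thesis by (metis last_snoc)
  qed
qed

text \<open>The component of \<open>v\<close> after the removal of the edge \<open>{u, v}\<close>. Naming the components by directed
  edges makes the recursive structure of a tree visible: the branch at \<open>v\<close> away from \<open>u\<close> consists
  of \<open>v\<close> and the branches at the other neighbours of \<open>v\<close> away from \<open>v\<close>.\<close>

definition branch :: "'a ugraph \<Rightarrow> 'a \<Rightarrow> 'a \<Rightarrow> 'a set" where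
  "branch T v u = {y \<in> uverts T. (v, y) \<in> (uadj (T\<lparr>uedges := uedges T - {{u, v}}\<rparr>))\<^sup>*}"

lemma branch_in_ucomponents:
  assumes "v \<in> uverts T"
  shows "branch T v u \<in> ucomponents (T\<lparr>uedges := uedges T - {{u, v}}\<rparr>)"
  using assms by (auto simp: branch_def ucomponents_def)

lemma branch_root: "v \<in> uverts T \<Longrightarrow> v \<in> branch T v u"
  by (simp add: branch_def)

lemma branch_step:
  assumes "simple_ugraph T" "y \<in> branch T v u" "{y, z} \<in> uedges T" "{y, z} \<noteq> {u, v}"
  shows "z \<in> branch T v u"
  using assms simple_edge_verts[OF assms(1,3)]
  by (auto simp: branch_def uadj_def intro: rtrancl_into_rtrancl)

lemma branch_induct [consumes 1, case_names root step]:
  assumes "y \<in> branch T v u"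
    and "P v"
    and "\<And>y z. \<lbrakk>(v, y) \<in> (uadj (T\<lparr>uedges := uedges T - {{u, v}}\<rparr>))\<^sup>*; P y; {y, z} \<in> uedges T;
           {y, z} \<noteq> {u, v}\<rbrakk> \<Longrightarrow> P z"
  shows "P y"
proof -
  have "(v, y) \<in> (uadj (T\<lparr>uedges := uedges T - {{u, v}}\<rparr>))\<^sup>*"
    using assms(1) by (simp add: branch_def)
  then show ?thesis
    by (induction rule: rtrancl_induct) (use assms(2,3) in \<open>auto simp: uadj_def\<close>)
qed

text \<open>A path from \<open>v\<close> to \<open>u\<close> that avoids the edge \<open>{u, v}\<close> would close to a cycle; it has at least
  three vertices, for otherwise it would be that edge.\<close>

lemma branch_excludes:
  assumes T: "utree T" and e: "{u, v} \<in> uedges T"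
  shows "u \<notin> branch T v u"
proof
  let ?T' = "T\<lparr>uedges := uedges T - {{u, v}}\<rparr>"
  assume "u \<in> branch T v u"
  have simp': "simple_ugraph ?T'" and simp: "simple_ugraph T"
    using T by (auto simp: utree_def simple_ugraph_def)
  have uv: "v \<in> uverts T" "u \<noteq> v"
    using simple_edge_verts[OF simp e] by auto
  from \<open>u \<in> branch T v u\<close> have "(v, u) \<in> (uadj ?T')\<^sup>*" by (simp add: branch_def)
  then obtain xs where xs: "upath ?T' xs" "hd xs = v" "last xs = u"
    using upath_of_reachable[OF _ simp'] uv by auto
  have "successively (\<lambda>u v. {u, v} \<in> uedges T) xs"
    using xs(1) by (auto simp: upath_def elim: successively_mono)
  then have "upath T xs" using xs(1) by (simp add: upath_def)
  moreover have "3 \<le> length xs"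
  proof (cases xs rule: remdups_adj.cases)
    case (3 a b ys)
    then have "ys \<noteq> []" using xs by (auto simp: upath_def insert_commute)
    then show ?thesis using 3 by (cases ys) auto
  qed (use xs uv in \<open>auto simp: upath_def\<close>)
  ultimately have "ucycle T xs" using xs e by (simp add: ucycle_def)
  then show False using T by (auto simp: utree_def)
qed

lemma branch_cover:
  assumes T: "utree T" and e: "{u, v} \<in> uedges T"
  shows "uverts T \<subseteq> branch T v u \<union> branch T u v"
proof
  fix y assume y: "y \<in> uverts T"
  have simp: "simple_ugraph T" using T by (simp add: utree_def)
  note uv = simple_edge_verts[OF simp e]
  have "(v, y) \<in> (uadj T)\<^sup>*" using T uv y by (auto simp: utree_def)
  then show "y \<in> branch T v u \<union> branch T u v"
  proof (induction rule: rtrancl_induct)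
    case base
    then show ?case using uv by (simp add: branch_root)
  next
    case (step y z)
    have yz: "{y, z} \<in> uedges T" using step by (simp add: uadj_def)
    show ?case
    proof (cases "{y, z} = {u, v}")
      case True
      then show ?thesis using uv by (auto simp: branch_root doubleton_eq_iff)
    next
      case False
      then show ?thesis
        using step.IH branch_step[OF simp _ yz, of v u] branch_step[OF simp _ yz, of u v]
        by (auto simp: insert_commute)
    qed
  qed
qed

text \<open>A walk from \<open>x\<close> without the edge \<open>{v, x}\<close> never reaches \<open>v\<close>, so it cannot use \<open>{u, v}\<close> either;
  preceded by the step from \<open>v\<close> to \<open>x\<close> it stays in the larger branch. The induction carries both
  memberships along to have this avoidance of \<open>v\<close> at hand.\<close>

lemma branch_subset:
  assumes T: "utree T" and e: "{u, v} \<in> uedges T" and x: "{v, x} \<in> uedges T" "x \<noteq> u"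
  shows "branch T x v \<subset> branch T v u"
proof
  have simp: "simple_ugraph T" using T by (simp add: utree_def)
  note vs = simple_edge_verts[OF simp e] simple_edge_verts[OF simp x(1)]
  have "v \<notin> branch T x v" using branch_excludes[OF T x(1)] .
  show "branch T x v \<noteq> branch T v u"
    using \<open>v \<notin> branch T x v\<close> vs branch_root by metis
  show "branch T x v \<subseteq> branch T v u"
  proof
    fix y assume "y \<in> branch T x v"
    then have "y \<in> branch T x v \<and> y \<in> branch T v u"
    proof (induction rule: branch_induct)
      case root
      have "{v, x} \<noteq> {u, v}" using x vs by (auto simp: doubleton_eq_iff)
      then show ?case
        using branch_step[OF simp branch_root x(1)] vs by (simp add: branch_root)
    next
      case (step y z)
      then have z: "z \<in> branch T x v"
        using branch_step[OF simp] by blast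
      then have "y \<noteq> v" "z \<noteq> v" using step \<open>v \<notin> branch T x v\<close> by auto
      then have "{y, z} \<noteq> {u, v}" by (auto simp: doubleton_eq_iff)
      then show ?case using z step branch_step[OF simp] by blast
    qed
    then show "y \<in> branch T v u" ..
  qed
qed

lemma branch_decompose:
  assumes T: "utree T" and e: "{u, v} \<in> uedges T"
  shows "branch T v u \<subseteq> insert v (\<Union>x\<in>{x. {v, x} \<in> uedges T} - {u}. branch T x v)"
proof
  have simp: "simple_ugraph T" using T by (simp add: utree_def)
  fix y assume "y \<in> branch T v u"
  then show "y \<in> insert v (\<Union>x\<in>{x. {v, x} \<in> uedges T} - {u}. branch T x v)"
  proof (induction rule: branch_induct)
    case root
    show ?case by simp
  next
    case (step y z)
    show ?case
    proof (cases "y = v")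
      case True
      then have "z \<noteq> u" using step by (auto simp: insert_commute)
      moreover have "z \<in> branch T z v"
        using branch_root step simple_edge_verts[OF simp] by metis
      ultimately show ?thesis using True step by auto
    next
      case False
      then obtain x where x: "{v, x} \<in> uedges T" "x \<noteq> u" "y \<in> branch T x v"
        using step by auto
      show ?thesis
      proof (cases "{y, z} = {v, x}")
        case True
        then show ?thesis using False by (auto simp: doubleton_eq_iff)
      next
        case False
        then have "z \<in> branch T x v"
          using branch_step[OF simp x(3)] \<open>{y, z} \<in> uedges T\<close> by blast
        then show ?thesis using x(1,2) by blast
      qed
    qed
  qed
qed

lemma udegree_eq_card_neighbors:
  assumes "simple_ugraph G"
  shows "udegree G v = card {x. {v, x} \<in> uedges G}"
proof -
  have "bij_betw (\<lambda>x. {v, x}) {x. {v, x} \<in> uedges G} {e \<in> uedges G. v \<in> e}"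
  proof (rule bij_betw_imageI)
    show "inj_on (\<lambda>x. {v, x}) {x. {v, x} \<in> uedges G}"
      by (auto simp: inj_on_def doubleton_eq_iff)
    show "(\<lambda>x. {v, x}) ` {x. {v, x} \<in> uedges G} = {e \<in> uedges G. v \<in> e}"
    proof (intro subset_antisym subsetI)
      fix e assume e: "e \<in> {e \<in> uedges G. v \<in> e}"
      then obtain a b where "e = {a, b}" using assms by (auto simp: simple_ugraph_def)
      then show "e \<in> (\<lambda>x. {v, x}) ` {x. {v, x} \<in> uedges G}"
        using e by (auto simp: image_iff insert_commute)
    qed auto
  qed
  then show ?thesis by (simp add: udegree_def bij_betw_same_card)
qed

text \<open>Among the branches that carry at least a third of \<open>W\<close> choose one with as few vertices as
  possible, say the branch at \<open>v\<close> away from \<open>u\<close>. If \<open>v\<close> is a leaf, the branch is \<open>{v}\<close> and carries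
  at most half of \<open>W\<close>, which has two elements or more. Otherwise
  it consists of \<open>v\<close>, which is not in \<open>W\<close>, and two smaller branches, each of which
  carries less than a third of \<open>W\<close> by minimality. In both cases the branch carries at most two
  thirds, so that a third remains on the other side.\<close>

theorem balanced_edge:
  assumes sub: "subcubic_tree T" and W: "W \<subseteq> uleaves T" "2 \<le> card W"
  shows "\<exists>e\<in>uedges T. \<exists>C\<in>ucomponents (T\<lparr>uedges := uedges T - {e}\<rparr>).
    card W \<le> 3 * card (W \<inter> C) \<and> card W \<le> 3 * card (W - C)"
proof -
  have T: "utree T" using sub by (simp add: subcubic_tree_def)
  have simp: "simple_ugraph T" using T by (simp add: utree_def)
  have finV: "finite (uverts T)" using simp by (simp add: simple_ugraph_def)
  have WV: "W \<subseteq> uverts T" using W by (auto simp: uleaves_def)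
  have finW: "finite W" using WV finV finite_subset by blast
  define heavy where "heavy = (\<lambda>(u, v). {u, v} \<in> uedges T \<and> card W \<le> 3 * card (W \<inter> branch T v u))"
  \<comment> \<open>The two branches of any edge cover the tree, so one of them carries half of \<open>W\<close>.\<close>
  have "\<exists>uv. heavy uv"
  proof -
    have "W \<noteq> {}" using W by auto
    then obtain w where w: "w \<in> W" by blast
    then have "udegree T w = 1" using W by (auto simp: uleaves_def)
    then have "{x. {w, x} \<in> uedges T} \<noteq> {}"
      by (metis udegree_eq_card_neighbors[OF simp] card.empty zero_neq_one)
    then obtain x where x: "{w, x} \<in> uedges T" by blast
    have "W = (W \<inter> branch T x w) \<union> (W \<inter> branch T w x)"
      using branch_cover[OF T x] WV by blast
    then have "card W \<le> card (W \<inter> branch T x w) + card (W \<inter> branch T w x)"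
      by (metis card_Un_le)
    then have "heavy (w, x) \<or> heavy (x, w)"
      using x by (auto simp: heavy_def insert_commute)
    then show ?thesis by blast
  qed
  then obtain uv where "heavy uv"
    and least: "\<And>uv'. heavy uv' \<Longrightarrow>
      (case uv of (u, v) \<Rightarrow> card (branch T v u)) \<le> (case uv' of (u, v) \<Rightarrow> card (branch T v u))"
    using ex_has_least_nat[of heavy _ "\<lambda>(u, v). card (branch T v u)"] by blast
  then obtain u v where h: "heavy (u, v)" and "uv = (u, v)"
    by (cases uv) simp
  then have min: "card (branch T v u) \<le> card (branch T v' u')" if "heavy (u', v')" for u' v'
    using least[OF that] by simp
  from h have e: "{u, v} \<in> uedges T" by (simp add: heavy_def)
  note uv = simple_edge_verts[OF simp e]
  define N where "N = {x. {v, x} \<in> uedges T}"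
  have deg: "udegree T v = card N" using udegree_eq_card_neighbors[OF simp] by (simp add: N_def)
  have decomp: "branch T v u \<subseteq> insert v (\<Union>x\<in>N - {u}. branch T x v)"
    using branch_decompose[OF T e] by (simp only: N_def)
  have finN: "finite N"
  proof (rule finite_subset[OF _ finV], rule subsetI)
    fix x assume "x \<in> N"
    then show "x \<in> uverts T" using simple_edge_verts[OF simp] unfolding N_def by blast
  qed
  have uN: "u \<in> N" using e by (simp add: N_def insert_commute)
  have light: "3 * card (W \<inter> branch T x v) < card W" if "x \<in> N - {u}" for x
  proof (rule ccontr)
    assume "\<not> ?thesis"
    then have "heavy (v, x)" using that by (simp add: N_def heavy_def)
    then have "card (branch T v u) \<le> card (branch T x v)" by (rule min)
    moreover have "branch T x v \<subset> branch T v u"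
      using branch_subset[OF T e] that unfolding N_def by blast
    moreover have "finite (branch T v u)" using finV by (simp add: branch_def)
    ultimately show False 
      using psubset_card_mono[of "branch T v u" "branch T x v"] by simp
  qed
  have "3 * card (W \<inter> branch T v u) \<le> 2 * card W"
  proof (cases "v \<in> uleaves T")
    case True
    then have "card N = 1" using deg by (simp add: uleaves_def)
    then have "N = {u}" using uN by (metis card_1_singletonE singletonD)
    then have "branch T v u \<subseteq> {v}" using decomp by simp
    then have "card (W \<inter> branch T v u) \<le> card {v}"
      by (intro card_mono) auto
    then show ?thesis using W by simp
  next
    case False
    then have "card N = 3"
      using sub uv deg by (simp add: subcubic_tree_def)
    then have "card (N - {u}) = 2" using uN finN by simp
    then obtain x y where xy: "N - {u} = {x, y}" by (meson card_2_iff)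
    have "W \<inter> branch T v u \<subseteq> (W \<inter> branch T x v) \<union> (W \<inter> branch T y v)"
      using decomp False W(1) unfolding xy by blast
    then have "card (W \<inter> branch T v u) \<le> card ((W \<inter> branch T x v) \<union> (W \<inter> branch T y v))"
      using finW by (intro card_mono) auto
    also have "\<dots> \<le> card (W \<inter> branch T x v) + card (W \<inter> branch T y v)" by (rule card_Un_le)
    finally show ?thesis using light[of x] light[of y] unfolding xy by simp
  qed
  moreover have "card W = card (W \<inter> branch T v u) + card (W - branch T v u)"
    using finW by (metis card_Int_Diff)
  ultimately have "card W \<le> 3 * card (W - branch T v u)" by linarith
  then show ?thesis
    using e h branch_in_ucomponents[OF uv(2), of u] by (auto simp: heavy_def)
qed


section \<open>Existence of linear branch decompositions\<close>

definition parent_graph :: "(nat \<Rightarrow> nat) \<Rightarrow> nat \<Rightarrow> nat ugraph" where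
  "parent_graph p N = \<lparr>uverts = {..<N}, uedges = {{i, p i} | i. 0 < i \<and> i < N}\<rparr>"

text \<open>Following parents leads from every vertex to \<open>0\<close>, hence the graph is connected. It has no cycle
  because the largest vertex \<open>m\<close> of a cycle would have two smaller neighbours on it, whereas
  \<open>p m\<close> is the only smaller neighbour of \<open>m\<close>.\<close>

lemma utree_parent_graph:
  assumes p: "\<And>i. 0 < i \<Longrightarrow> p i < i" and N: "0 < N"
  shows "utree (parent_graph p N)"
  unfolding utree_def
proof (intro conjI ballI)
  let ?T = "parent_graph p N"
  show "simple_ugraph ?T"
    unfolding simple_ugraph_def
  proof (intro conjI ballI)
    show "finite (uverts ?T)" by (simp add: parent_graph_def)
    fix e assume "e \<in> uedges ?T"
    then obtain i where "e = {i, p i}" "0 < i" "i < N" by (auto simp: parent_graph_def)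
    then show "\<exists>u\<in>uverts ?T. \<exists>v\<in>uverts ?T. u \<noteq> v \<and> e = {u, v}"
      using p[of i] by (intro bexI[of _ i] bexI[of _ "p i"]) (auto simp: parent_graph_def)
  qed
  show "uverts ?T \<noteq> {}" using N by (auto simp: parent_graph_def)
  have root: "(x, 0) \<in> (uadj ?T)\<^sup>*" if "x < N" for x
    using that
  proof (induction x rule: less_induct)
    case (less x)
    show ?case
    proof (cases "x = 0")
      case False
      then have "(x, p x) \<in> uadj ?T"
        using less.prems by (auto simp: uadj_def parent_graph_def)
      moreover have "(p x, 0) \<in> (uadj ?T)\<^sup>*"
        using less p[of x] False by auto
      ultimately show ?thesis by (rule converse_rtrancl_into_rtrancl)
    qed simp
  qed
  fix x y assume "x \<in> uverts ?T" "y \<in> uverts ?T"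
  then have "x < N" "y < N" by (auto simp: parent_graph_def)
  then show "(x, y) \<in> (uadj ?T)\<^sup>*"
    using root uadj_rtrancl_sym by (metis rtrancl_trans)
next
  let ?T = "parent_graph p N"
  have down: "y = p x" if "{x, y} \<in> uedges ?T" "y < x" for x y
  proof -
    have "{x, y} \<in> {{i, p i} | i. 0 < i \<and> i < N}"
      using that(1) by (simp add: parent_graph_def)
    then obtain i where i: "{x, y} = {i, p i}" "0 < i" by blast
    then show ?thesis using p[of i] that(2) by (auto simp: doubleton_eq_iff)
  qed
  show "\<nexists>xs. ucycle ?T xs"
  proof
    assume "\<exists>xs. ucycle ?T xs"
    then obtain xs where xs: "ucycle ?T xs" ..
    define l where "l = length xs"
    have l: "3 \<le> l" and dist: "distinct xs" and ne: "xs \<noteq> []"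
      using xs by (auto simp: ucycle_def upath_def l_def)
    have edge: "{xs ! i, xs ! (Suc i mod l)} \<in> uedges ?T" if "i < l" for i
    proof (cases "Suc i < l")
      case True
      then show ?thesis using xs
        by (auto simp: ucycle_def upath_def l_def successively_conv_nth)
    next
      case False
      then have "Suc i = l" using that by simp
      then have "i = l - 1" "Suc i mod l = 0" by auto
      then show ?thesis using xs ne
        by (auto simp: ucycle_def l_def last_conv_nth hd_conv_nth)
    qed
    define m where "m = Max (set xs)"
    have m: "m \<in> set xs" "\<And>y. y \<in> set xs \<Longrightarrow> y \<le> m"
      using ne by (auto simp: m_def)
    then obtain i where i: "i < l" "xs ! i = m" by (auto simp: in_set_conv_nth l_def)
    \<comment> \<open>\<open>a\<close> and \<open>b\<close> are the positions after and before \<open>m\<close> in the cyclic order; they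
      differ because the cycle has at least three vertices.\<close>
    define a b where "a = Suc i mod l" and "b = (if i = 0 then l - 1 else i - 1)"
    have ab: "a < l" "b < l" "a \<noteq> b" "a \<noteq> i" "b \<noteq> i" "Suc b mod l = i"
      using i(1) l by (auto simp: a_def b_def mod_Suc)
    have "xs ! a < m" "xs ! b < m"
      using m(2) ab i dist by (metis l_def le_neq_implies_less nth_eq_iff_index_eq nth_mem)+
    moreover have "{m, xs ! a} \<in> uedges ?T" "{m, xs ! b} \<in> uedges ?T"
      using edge[OF i(1)] edge[OF ab(2)] ab i by (simp_all add: a_def insert_commute)
    ultimately have "xs ! a = xs ! b" using down by metis
    then show False using ab dist by (simp add: l_def nth_eq_iff_index_eq)
  qed
qed

text \<open>The witness is a path \<open>1, 3, 5, \<dots>, N - 1\<close> on the odd numbers below \<open>N = 2 (n - 1)\<close>, with \<open>0\<close>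
  attached to \<open>1\<close> and every other even \<open>i\<close> attached to \<open>i - 1\<close>. The function \<open>p\<close> below
  sends every \<open>i > 0\<close> to its only smaller neighbour. The leaves are the \<open>n - 1\<close> even numbers and the
  last vertex \<open>N - 1\<close>; for \<open>n = 2\<close> the tree is the single edge \<open>{0, 1}\<close>.\<close>

lemma caterpillar_exists:
  assumes n: "2 \<le> n"
  shows "\<exists>T :: nat ugraph. subcubic_tree T \<and> caterpillar T \<and> card (uleaves T) = n"
proof -
  \<comment> \<open>Truncated subtraction makes \<open>0\<close> the parent of \<open>1\<close>.\<close>
  define p where "p i = 2 * (i div 2) - 1" for i :: nat
  define N where "N = 2 * (n - 1)"
  define T where "T = parent_graph p N"
  have N: "2 \<le> N" "even N" using n by (auto simp: N_def)
  have verts: "uverts T = {..<N}" by (simp add: T_def parent_graph_def)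
  have p_less: "p i < i" if "0 < i" for i
    using that by (auto simp: p_def)
  have tree: "utree T"
    unfolding T_def using utree_parent_graph[of p N] p_less N by auto
  have simp: "simple_ugraph T" using tree by (simp add: utree_def)
  have adj: "{v, x} \<in> uedges T \<longleftrightarrow> 0 < v \<and> v < N \<and> x = p v \<or> 0 < x \<and> x < N \<and> v = p x" for v x
    by (auto simp: T_def parent_graph_def doubleton_eq_iff)
  have nb_even: "{x. {v, x} \<in> uedges T} = {if v = 0 then 1 else v - 1}" if "v < N" "even v" for v
  proof -
    have root: "v = p x \<longleftrightarrow> v = 0 \<and> x = 1" if "0 < x" for x
    proof (cases "x = 1")
      case True
      then show ?thesis by (simp add: p_def)
    next
      case False
      then have "0 < x div 2" using \<open>0 < x\<close> by (simp add: div_greater_zero_iff)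
      then have "odd (p x)" by (simp add: p_def)
      then show ?thesis using \<open>even v\<close> False by auto
    qed
    have "p v = v - 1" using \<open>even v\<close> by (simp add: p_def)
    then have "{v, x} \<in> uedges T \<longleftrightarrow> x = (if v = 0 then 1 else v - 1)" for x
      using root[of x] \<open>v < N\<close> N unfolding adj[of v x] by (cases "v = 0"; cases "x = 0") auto
    then show ?thesis by auto
  qed
  have nb_last: "{x. {v, x} \<in> uedges T} = {p v}" if "v = N - 1" for v
    using that N unfolding adj p_def by auto
  have nb_odd: "{x. {v, x} \<in> uedges T} = {p v, v + 1, v + 2}" if "v < N - 1" "odd v" for v
  proof -
    have child: "v = p x \<longleftrightarrow> x = v + 1 \<or> x = v + 2" for x
    proof -
      obtain k where k: "v = 2 * k + 1" using \<open>odd v\<close> by (elim oddE)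
      have "v = p x \<longleftrightarrow> x div 2 = k + 1" unfolding k p_def by linarith
      also have "\<dots> \<longleftrightarrow> x = v + 1 \<or> x = v + 2" unfolding k by presburger
      finally show ?thesis .
    qed
    have "v + 2 < N" using that N by presburger
    then show ?thesis using odd_pos[OF that(2)] unfolding adj child by auto
  qed
  have deg: "udegree T v = (if even v \<or> v = N - 1 then 1 else 3)" if "v < N" for v
  proof -
    consider "even v" | "v = N - 1" | "odd v" "v < N - 1" using \<open>v < N\<close> by linarith
    then show ?thesis
    proof cases
      case 3
      then have "p v < v" using p_less by (simp add: odd_pos)
      then have "card {p v, v + 1, v + 2} = 3" by simp
      then show ?thesis using 3 nb_odd[OF 3(2,1)] by (simp add: udegree_eq_card_neighbors[OF simp])
    qed (use nb_even[OF that] nb_last in \<open>simp_all add: udegree_eq_card_neighbors[OF simp]\<close>)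
  qed
  have leaves: "uleaves T = insert (N - 1) ((\<lambda>k. 2 * k) ` {..<n - 1})"
  proof -
    have "v \<in> uleaves T \<longleftrightarrow> v = N - 1 \<or> v < N \<and> even v" for v
      using N(1) by (cases "v < N") (auto simp: uleaves_def verts deg[of v])
    then have "uleaves T = insert (N - 1) {v. v < N \<and> even v}" by blast
    also have "{v. v < N \<and> even v} = (\<lambda>k. 2 * k) ` {..<n - 1}"
      by (auto simp: N_def elim!: evenE)
    finally show ?thesis .
  qed
  have "N - 1 \<notin> (\<lambda>k. 2 * k) ` {..<n - 1}"
    using N by (auto simp: N_def)
  then have card: "card (uleaves T) = n"
    using n by (simp add: leaves card_image inj_on_def)
  have sub: "subcubic_tree T"
    unfolding subcubic_tree_def using tree N by (auto simp: verts uleaves_def deg)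
  have "caterpillar T"
    unfolding caterpillar_def
  proof (intro exI conjI ballI)
    let ?P = "map (\<lambda>k. 2 * k + 1) [0..<n - 1]"
    show "upath T ?P"
      unfolding upath_def
    proof (intro conjI)
      show "?P \<noteq> []" using n by simp
      show "set ?P \<subseteq> uverts T" by (auto simp: verts N_def)
      show "distinct ?P" by (simp add: distinct_map inj_on_def)
      show "successively (\<lambda>u v. {u, v} \<in> uedges T) ?P"
        by (auto simp: successively_conv_nth adj p_def N_def)
    qed
    fix v assume v: "v \<in> uverts T - set ?P"
    have "even v"
    proof (rule ccontr)
      assume "odd v"
      then obtain k where k: "v = 2 * k + 1" by (elim oddE)
      then have "k < n - 1" using v by (auto simp: verts N_def)
      then have "v \<in> set ?P" using k by auto
      then show False using v by blast
    qed
    define u where "u = (if v = 0 then 1 else v - 1)"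
    have "{v, u} \<in> uedges T"
      using nb_even[of v] \<open>even v\<close> v by (auto simp: verts u_def)
    then have "{u, v} \<in> uedges T" by (simp add: insert_commute)
    moreover have "u \<in> set ?P"
    proof (cases "v = 0")
      case True
      then show ?thesis using n by (auto simp: u_def image_iff intro!: bexI[of _ 0])
    next
      case False
      then have "u = 2 * (v div 2 - 1) + 1" "v div 2 - 1 < n - 1"
        using \<open>even v\<close> v by (auto simp: u_def verts N_def elim!: evenE)
      then show ?thesis by auto
    qed
    ultimately show "\<exists>u\<in>set ?P. {u, v} \<in> uedges T" by blast
  qed
  then show ?thesis using sub card by blast
qed

corollary linear_branch_decomposition_exists:
  assumes "2 \<le> card V"
  shows "\<exists>(T :: nat ugraph) L. linear_branch_decomposition V T L"
proof -
  obtain T :: "nat ugraph" where T: "subcubic_tree T" "caterpillar T" "card (uleaves T) = card V"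
    using caterpillar_exists[OF assms] by blast
  have "finite V" "finite (uleaves T)"
    using assms T(3) by (auto intro: card_ge_0_finite)
  then obtain L where "bij_betw L V (uleaves T)"
    using T(3) by (metis finite_same_card_bij)
  then show ?thesis
    using T by (auto simp: linear_branch_decomposition_def branch_decomposition_def)
qed


section \<open>Widths\<close>

lemma finite_cut_values:
  assumes "branch_decomposition V T L"
  shows "finite {f {v \<in> V. L v \<in> C} | e C.
    e \<in> uedges T \<and> C \<in> ucomponents (T\<lparr>uedges := uedges T - {e}\<rparr>)}"
proof -
  have simp: "simple_ugraph T"
    using assms by (simp add: branch_decomposition_def subcubic_tree_def utree_def)
  have "{f {v \<in> V. L v \<in> C} | e C.
      e \<in> uedges T \<and> C \<in> ucomponents (T\<lparr>uedges := uedges T - {e}\<rparr>)}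
    \<subseteq> (\<lambda>C. f {v \<in> V. L v \<in> C}) ` Pow (uverts T)"
    by (auto simp: ucomponents_def)
  moreover have "finite (uverts T)" using simp by (simp add: simple_ugraph_def)
  ultimately show ?thesis by (meson finite_Pow_iff finite_imageI finite_subset)
qed

lemma decomposition_width_ge:
  assumes "branch_decomposition V T L" and "e \<in> uedges T"
    and "C \<in> ucomponents (T\<lparr>uedges := uedges T - {e}\<rparr>)"
  shows "f {v \<in> V. L v \<in> C} \<le> decomposition_width f V T L"
  unfolding decomposition_width_def
  using assms by (intro Max_ge finite_cut_values) auto

text \<open>Stated for all cut functions at once, so that a single cut can bound the width from below
  for \<open>mim\<close> as well as for \<open>bimim\<close>.\<close>

lemma balanced_cut:
  assumes dec: "branch_decomposition V T L" and A: "A \<subseteq> V" "2 \<le> card A"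
  obtains X where "card A \<le> 3 * card (A \<inter> X)" "card A \<le> 3 * card (A - X)"
    "\<And>f. f X \<le> decomposition_width f V T L"
proof -
  have L: "bij_betw L V (uleaves T)" and T: "subcubic_tree T"
    using dec by (auto simp: branch_decomposition_def)
  have inj: "inj_on L A" using L A by (meson bij_betw_imp_inj_on inj_on_subset)
  have "L ` A \<subseteq> uleaves T" using L A by (auto simp: bij_betw_def)
  moreover have "card (L ` A) = card A" using inj by (rule card_image)
  ultimately obtain e C where eC: "e \<in> uedges T" "C \<in> ucomponents (T\<lparr>uedges := uedges T - {e}\<rparr>)"
    "card A \<le> 3 * card (L ` A \<inter> C)" "card A \<le> 3 * card (L ` A - C)"
    using balanced_edge[OF T, of "L ` A"] A(2) by metis
  let ?X = "{v \<in> V. L v \<in> C}"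
  have "L ` A \<inter> C = L ` (A \<inter> ?X)" "L ` A - C = L ` (A - ?X)" using A(1) by auto
  moreover have "inj_on L (A \<inter> ?X)" "inj_on L (A - ?X)"
    using inj by (auto intro: inj_on_subset)
  ultimately have "card (L ` A \<inter> C) = card (A \<inter> ?X)" "card (L ` A - C) = card (A - ?X)"
    by (simp_all add: card_image)
  with eC that[of ?X] decomposition_width_ge[OF dec eC(1,2)] show ?thesis by metis
qed

lemma decomposition_width_le:
  assumes dec: "branch_decomposition V T L" and V: "2 \<le> card V"
    and le: "\<And>e C. \<lbrakk>e \<in> uedges T; C \<in> ucomponents (T\<lparr>uedges := uedges T - {e}\<rparr>)\<rbrakk>
      \<Longrightarrow> f {v \<in> V. L v \<in> C} \<le> w"
  shows "decomposition_width f V T L \<le> w"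
proof -
  have L: "bij_betw L V (uleaves T)" and T: "subcubic_tree T"
    using dec by (auto simp: branch_decomposition_def)
  \<comment> \<open>The maximum ranges over a nonempty set because the tree has an edge, which a balanced
    edge certainly provides.\<close>
  have "2 \<le> card (uleaves T)" using V bij_betw_same_card[OF L] by simp
  from balanced_edge[OF T order_refl this]
  have "{f {v \<in> V. L v \<in> C} | e C.
      e \<in> uedges T \<and> C \<in> ucomponents (T\<lparr>uedges := uedges T - {e}\<rparr>)} \<noteq> {}"
    by blast
  then show ?thesis
    unfolding decomposition_width_def
    using finite_cut_values[OF dec, of f] le by (subst Max_le_iff) auto
qed

lemma decomposition_width_mono:
  assumes dec: "branch_decomposition V T L" and V: "2 \<le> card V"
    and le: "\<And>X. f X \<le> g X"
  shows "decomposition_width f V T L \<le> decomposition_width g V T L"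
  by (intro decomposition_width_le[OF dec V] order_trans[OF le decomposition_width_ge[OF dec]])

lemma Least_width_attained:
  fixes g :: "'t \<Rightarrow> 'l \<Rightarrow> nat"
  assumes "\<exists>T L. P T L"
  shows "\<exists>T L. P T L \<and> (LEAST w. \<exists>T L. P T L \<and> w = g T L) = g T L"
proof -
  have "\<exists>w. \<exists>T L. P T L \<and> w = g T L" using assms by blast
  then show ?thesis by (rule LeastI_ex)
qed

lemma Least_width_mono:
  fixes f g :: "'t \<Rightarrow> 'l \<Rightarrow> nat"
  assumes ex: "\<exists>T L. P T L" and le: "\<And>T L. P T L \<Longrightarrow> f T L \<le> g T L"
  shows "(LEAST w. \<exists>T L. P T L \<and> w = f T L) \<le> (LEAST w. \<exists>T L. P T L \<and> w = g T L)"
proof -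
  obtain T L where TL: "P T L" "(LEAST w. \<exists>T L. P T L \<and> w = g T L) = g T L"
    using Least_width_attained[OF ex] by blast
  have "(LEAST w. \<exists>T L. P T L \<and> w = f T L) \<le> f T L"
    using TL(1) by (intro Least_le) blast
  then show ?thesis using le[OF TL(1)] TL(2) by simp
qed

lemma uverts_underlying [simp]: "uverts (underlying_ugraph G) = pverts G"
  by (simp add: underlying_ugraph_def)

lemma branch_decomposition_exists:
  assumes "2 \<le> card V"
  shows "\<exists>(T :: nat ugraph) L. branch_decomposition V T L"
  using linear_branch_decomposition_exists[OF assms]
  by (auto simp: linear_branch_decomposition_def)

lemma mim_width_underlying_le:
  assumes "pair_fin_digraph G" "2 \<le> card (pverts G)"
  shows "mim_width (underlying_ugraph G) \<le> bimim_width G"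
  unfolding mim_width_def bimim_width_def uverts_underlying
  using assms
  by (intro Least_width_mono branch_decomposition_exists decomposition_width_mono mim_le_bimim)

lemma linear_mim_width_underlying_le:
  assumes "pair_fin_digraph G" "2 \<le> card (pverts G)"
  shows "linear_mim_width (underlying_ugraph G) \<le> linear_bimim_width G"
  unfolding linear_mim_width_def linear_bimim_width_def uverts_underlying
  using assms
  by (intro Least_width_mono linear_branch_decomposition_exists decomposition_width_mono
      mim_le_bimim) (simp_all add: linear_branch_decomposition_def)

text \<open>All cuts have value at most 1, and a balanced cut has vertices on both sides, so the width is 1 for
  every decomposition.\<close>

lemma linear_mim_width_tournament:
  assumes G: "tournament G" and V: "2 \<le> card (pverts G)"
  shows "linear_mim_width (underlying_ugraph G) = 1"
proof -
  have width: "decomposition_width (mim (underlying_ugraph G)) (pverts G) T L = 1"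
    if "linear_branch_decomposition (pverts G) T L" for T :: "nat ugraph" and L
  proof (rule antisym)
    have dec: "branch_decomposition (pverts G) T L"
      using that by (simp add: linear_branch_decomposition_def)
    show "decomposition_width (mim (underlying_ugraph G)) (pverts G) T L \<le> 1"
      by (intro decomposition_width_le[OF dec V] mim_underlying_tournament_le[OF G])
    obtain X where X: "card (pverts G) \<le> 3 * card (pverts G \<inter> X)"
      "card (pverts G) \<le> 3 * card (pverts G - X)"
      "\<And>f. f X \<le> decomposition_width f (pverts G) T L"
      using balanced_cut[OF dec order_refl V] by metis
    have "pverts G \<inter> X \<noteq> {}" "pverts G - X \<noteq> {}"
      using X(1,2) V by (metis card.empty mult_0_right not_numeral_le_zero order_trans)+
    then obtain u v where "u \<in> pverts G" "u \<in> X" "v \<in> pverts G" "v \<notin> X" by blast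
    from mim_underlying_tournament_pos[OF G this] X(3)
    show "1 \<le> decomposition_width (mim (underlying_ugraph G)) (pverts G) T L"
      by (meson order_trans)
  qed
  have "\<exists>(T :: nat ugraph) L. linear_branch_decomposition (pverts G) T L \<and>
      linear_mim_width (underlying_ugraph G) =
        decomposition_width (mim (underlying_ugraph G)) (pverts G) T L"
    unfolding linear_mim_width_def uverts_underlying
    by (rule Least_width_attained[OF linear_branch_decomposition_exists[OF V]])
  then show ?thesis using width by auto
qed


section \<open>Tournaments of large bi-mim-width\<close>

text \<open>The points are the numbers below \<open>n\<close>; the number \<open>n + (p * n + q)\<close> stands for the pair
  \<open>{p, q}\<close>. Every pair has two such codes, and the codes with \<open>p = q\<close> stand for single points; these
  redundant vertices spare a normal form and do no harm to a lower bound.\<close>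

definition incident :: "nat \<Rightarrow> nat \<Rightarrow> nat \<Rightarrow> bool" where
  "incident n a b \<longleftrightarrow> a = (b - n) div n \<or> a = (b - n) mod n"

definition incidence_tournament :: "nat \<Rightarrow> nat pair_pre_digraph" where
  "incidence_tournament n = \<lparr>pverts = {..<n + n * n},
     parcs = {(u, v). u < n + n * n \<and> v < n + n * n \<and>
       (if u < n \<and> n \<le> v then incident n u v
        else if v < n \<and> n \<le> u then \<not> incident n v u
        else u < v)}\<rparr>"

lemma tournament_incidence_tournament: "tournament (incidence_tournament n)"
proof -
  have "finite (parcs (incidence_tournament n))"
    by (rule finite_subset[of _ "{..<n + n * n} \<times> {..<n + n * n}"])
      (auto simp: incidence_tournament_def)
  then have "pair_fin_digraph (incidence_tournament n)"
    by unfold_locales (auto simp: incidence_tournament_def)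
  then show ?thesis
    unfolding tournament_def by (auto simp: incidence_tournament_def)
qed

lemma pair_vertex:
  assumes "p < n" "q < n"
  shows "n \<le> n + (p * n + q)" "n + (p * n + q) < n + n * n"
    and "incident n a (n + (p * n + q)) \<longleftrightarrow> a = p \<or> a = q"
proof -
  have "p * n + q < p * n + n" using assms by simp
  also have "\<dots> = Suc p * n" by simp
  also have "\<dots> \<le> n * n" using assms by (intro mult_le_mono1) simp
  finally show "n + (p * n + q) < n + n * n" by simp
  show "incident n a (n + (p * n + q)) \<longleftrightarrow> a = p \<or> a = q"
    using assms by (simp add: incident_def)
qed simp

text \<open>Match \<open>P\<close> with \<open>Q\<close> by a bijection \<open>h\<close> and let \<open>b p\<close> be the vertex of the pair \<open>{p, h p}\<close>. If
  \<open>b p\<close> lies outside \<open>X\<close>, the arc \<open>(p, b p)\<close> leaves \<open>X\<close>; otherwise \<open>(h p, b p)\<close> enters \<open>X\<close>. Both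
  families are induced matchings, since \<open>P\<close> and \<open>Q\<close> are disjoint and a point of \<open>P \<union> Q\<close> thus
  belongs to only one of the chosen pairs.\<close>

lemma bimim_incidence_tournament_ge:
  assumes P: "P \<subseteq> {..<n} \<inter> X" and Q: "Q \<subseteq> {..<n} - X" and PQ: "card P = card Q"
  shows "card P \<le> bimim (incidence_tournament n) X"
proof -
  let ?G = "incidence_tournament n"
  define E1 where "E1 = parcs ?G \<inter> X \<times> (pverts ?G - X)"
  define E2 where "E2 = parcs ?G \<inter> (pverts ?G - X) \<times> X"
  have fin: "finite (parcs ?G)"
    using tournament_incidence_tournament[of n]
    by (simp add: tournament_def pair_fin_digraph.pair_finite_arcs)
  have finPQ: "finite P" "finite Q" using P Q finite_subset by blast+
  obtain h where h: "bij_betw h P Q" using finite_same_card_bij[OF finPQ PQ] by blast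
  have hQ: "h p \<in> Q" if "p \<in> P" for p using h that by (rule bij_betwE[THEN bspec])
  have hinj: "p = q" if "p \<in> P" "q \<in> P" "h p = h q" for p q
    using h that by (auto simp: bij_betw_def inj_on_def)
  define b where "b p = n + (p * n + h p)" for p
  have b: "n \<le> b p" "b p < n + n * n" "incident n a (b p) \<longleftrightarrow> a = p \<or> a = h p" if "p \<in> P" for a p
    using pair_vertex[of p n "h p"] that hQ[OF that] P Q by (auto simp: b_def)
  have arc: "(a, b p) \<in> parcs ?G \<longleftrightarrow> a = p \<or> a = h p" if "p \<in> P" "a < n" for a p
    using b[OF that(1)] that by (auto simp: incidence_tournament_def)
  have PQ': "p < n" "p \<in> X" "h p < n" "h p \<notin> X" if "p \<in> P" for p
    using that hQ[OF that] P Q by auto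
  have verts: "pverts ?G = {..<n + n * n}" by (simp add: incidence_tournament_def)
  define P1 P2 where "P1 = {p \<in> P. b p \<notin> X}" and "P2 = {p \<in> P. b p \<in> X}"
  have 1: "card P1 \<le> induced_matching_number (\<lambda>(u, v). {u, v}) E1"
  proof -
    have arcs: "(p, b p) \<in> E1" if "p \<in> P1" for p
      using that arc PQ' b by (auto simp: P1_def E1_def verts)
    have only: "p = q" if "p \<in> P1" "q \<in> P1" "(p, b q) \<in> E1" for p q
      using that arc[of q p] PQ' by (auto simp: P1_def E1_def)
    have E: "E1 \<subseteq> X \<times> (pverts ?G - X)" by (auto simp: E1_def)
    have im: "induced_matching (\<lambda>(u, v). {u, v}) E1 ((\<lambda>p. (p, b p)) ` P1)"
      using E Diff_disjoint arcs only by (rule induced_matching_of_family)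
    have "card ((\<lambda>p. (p, b p)) ` P1) = card P1"
      by (intro card_image inj_onI) simp
    moreover have "finite E1" using fin by (simp add: E1_def)
    ultimately show ?thesis
      using induced_matching_card_le[OF _ im] by simp
  qed
  have 2: "card P2 \<le> induced_matching_number (\<lambda>(u, v). {u, v}) E2"
  proof -
    have arcs: "(h p, b p) \<in> E2" if "p \<in> P2" for p
      using that arc PQ'[of p] b by (auto simp: P2_def E2_def verts)
    have only: "p = q" if "p \<in> P2" "q \<in> P2" "(h p, b q) \<in> E2" for p q
      using that arc[of q "h p"] PQ' hinj by (auto simp: P2_def E2_def)
    have E: "E2 \<subseteq> (pverts ?G - X) \<times> X" by (auto simp: E2_def)
    have disj: "(pverts ?G - X) \<inter> X = {}" by blast
    have im: "induced_matching (\<lambda>(u, v). {u, v}) E2 ((\<lambda>p. (h p, b p)) ` P2)"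
      using E disj arcs only by (rule induced_matching_of_family)
    have "card ((\<lambda>p. (h p, b p)) ` P2) = card P2"
      using hinj by (intro card_image inj_onI) (auto simp: P2_def)
    moreover have "finite E2" using fin by (simp add: E2_def)
    ultimately show ?thesis
      using induced_matching_card_le[OF _ im] by simp
  qed
  have "P = P1 \<union> P2" by (auto simp: P1_def P2_def)
  then have "card P \<le> card P1 + card P2" by (metis card_Un_le)
  also have "\<dots> \<le> bimim ?G X" using 1 2 by (simp add: bimim_def E1_def E2_def)
  finally show ?thesis .
qed

lemma bimim_width_incidence_tournament_ge:
  assumes m: "1 \<le> m"
  shows "m \<le> bimim_width (incidence_tournament (3 * m))"
proof -
  let ?n = "3 * m"
  let ?G = "incidence_tournament ?n"
  have verts: "pverts ?G = {..<?n + ?n * ?n}" by (simp add: incidence_tournament_def)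
  have V: "2 \<le> card (pverts ?G)" using m by (simp add: verts)
  have "\<exists>(T :: nat ugraph) L. branch_decomposition (pverts ?G) T L \<and>
      bimim_width ?G = decomposition_width (bimim ?G) (pverts ?G) T L"
    unfolding bimim_width_def
    by (rule Least_width_attained[OF branch_decomposition_exists[OF V]])
  then obtain T :: "nat ugraph" and L where dec: "branch_decomposition (pverts ?G) T L"
    and w: "bimim_width ?G = decomposition_width (bimim ?G) (pverts ?G) T L"
    by blast
  have "{..<?n} \<subseteq> pverts ?G" "2 \<le> card {..<?n}" using m by (auto simp: verts)
  then obtain X where X: "?n \<le> 3 * card ({..<?n} \<inter> X)" "?n \<le> 3 * card ({..<?n} - X)"
    "bimim ?G X \<le> decomposition_width (bimim ?G) (pverts ?G) T L"
    using balanced_cut[OF dec] by (metis card_lessThan)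
  obtain P where P: "P \<subseteq> {..<?n} \<inter> X" "card P = m"
    using X(1) by (meson mult_le_cancel1 obtain_subset_with_card_n zero_less_numeral)
  obtain Q where Q: "Q \<subseteq> {..<?n} - X" "card Q = m"
    using X(2) by (meson mult_le_cancel1 obtain_subset_with_card_n zero_less_numeral)
  have "m \<le> bimim ?G X"
    using bimim_incidence_tournament_ge[OF P(1) Q(1)] P(2) Q(2) by simp
  then show ?thesis using X(3) w by simp
qed

theorem unbounded_bimim_width_tournaments:
  "unbounded_bimim_width {G :: nat pair_pre_digraph. tournament G \<and> 2 \<le> card (pverts G)}"
  unfolding unbounded_bimim_width_def
proof
  assume "\<exists>c. \<forall>G\<in>{G :: nat pair_pre_digraph. tournament G \<and> 2 \<le> card (pverts G)}. bimim_width G \<le> c"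
  then obtain c where c: "\<And>G :: nat pair_pre_digraph.
      \<lbrakk>tournament G; 2 \<le> card (pverts G)\<rbrakk> \<Longrightarrow> bimim_width G \<le> c"
    by blast
  let ?G = "incidence_tournament (3 * Suc c)"
  have "2 \<le> card (pverts ?G)" by (simp add: incidence_tournament_def)
  then have "bimim_width ?G \<le> c" using c tournament_incidence_tournament by blast
  moreover have "Suc c \<le> bimim_width ?G" by (rule bimim_width_incidence_tournament_ge) simp
  ultimately show False by simp
qed


section \<open>Mim-width and bi-mim-width\<close>

theorem lemma3p5:
  "(\<forall>G :: 'a pair_pre_digraph. pair_fin_digraph G \<and> 2 \<le> card (pverts G) \<longrightarrow>
      mim_width (underlying_ugraph G) \<le> bimim_width G \<and>
      linear_mim_width (underlying_ugraph G) \<le> linear_bimim_width G) \<and>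
   unbounded_bimim_width {G :: nat pair_pre_digraph. tournament G \<and> 2 \<le> card (pverts G)} \<and>
   (\<forall>G :: 'a pair_pre_digraph. tournament G \<and> 2 \<le> card (pverts G) \<longrightarrow>
      linear_mim_width (underlying_ugraph G) = 1)"
  using mim_width_underlying_le linear_mim_width_underlying_le
    unbounded_bimim_width_tournaments linear_mim_width_tournament
  by blast

end
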